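(* Let $(\gamma,\nu):I\to\Delta_1$ be a spacelike Legendre curve with curvature $(m,n)$ such that $\{t\in I:n(t)\ne0\}$ is dense in $I$, and let $(x_N^\pm,\nu_N^\pm):\mathbb R\times I\to\Delta_1$ be the one-parameter family of spacelike Legendre curves given by $$x_N^\pm(s,t)=\gamma(t)+s\nu(t)+\frac{s^2}{2}(\gamma(t)\pm\mu(t)),\qquad \nu_N^\pm(s,t)=\mp\mu(t)+s\nu(t)+\frac{s^2}{2}(\gamma(t)\pm\mu(t)).$$ Let $\lambda_\pm:I\to\mathbb R$ be a solution of $\dot\lambda_\pm=\mp\left(\frac{\lambda_\pm^2n}{2}+\lambda_\pm m\right)$, that is, $\lambda_\pm(t)=0$ for all $t\in I$ or $$\lambda_\pm(t)=\frac{2e^{\int\mp m(t)\,dt}}{\pm\int n(t)e^{\int\mp m(t)\,dt}\,dt+c}\quad\text{for all }t\in I,$$ where $c$ is a constant. Then the map $e_N^\pm[\pi/2]:I\to\mathbb R\times I$, $e_N^\pm[\pi/2](t)=(\lambda_\pm(t),t)$, is a pre-$\pi/2$-enveloid of $x_N^\pm$, and the horocyclic parallel of $\gamma$, $$P^\pm(\gamma,\lambda_\pm)(t)=x_N^\pm\circ e_N^\pm[\pi/2](t)=E_N^\pm[\pi/2](t),$$ is a $\pi/2$-enveloid (normal envelope) of $x_N^\pm$.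
   Context: All maps are $C^\infty$; $I,J,U\subset\mathbb R$ are intervals; a dot denotes the derivative. In every formula with $\pm,\mp$ the upper signs are taken together and the lower signs together. $\mathbb R^3_1$ is $\mathbb R^3$ with $\langle x,y\rangle=-x_1y_1+x_2y_2+x_3y_3$ and $x\wedge y=(-(x_2y_3-x_3y_2),\,x_3y_1-x_1y_3,\,x_1y_2-x_2y_1)$. $H^2=\{x:\langle x,x\rangle=-1,\ x_1>0\}$, $S^2_1=\{x:\langle x,x\rangle=1\}$, $\Delta_1=\{(\nu_1,\nu_2)\in H^2\times S_1^2:\langle\nu_1,\nu_2\rangle=0\}$. A spacelike Legendre curve is a map $(\gamma,\nu):I\to\Delta_1$ with $\langle\dot\gamma,\nu\rangle=0$ on $I$; put $\mu=\gamma\wedge\nu$. Its curvature is the pair $(m,n)$ with $\dot\gamma=m\mu$, $\dot\nu=n\mu$ (then $\dot\mu=m\gamma-n\nu$). A one-parameter family of spacelike Legendre curves is a map $(x,\eta):J\times I\to\Delta_1$ with $\langle x_s,\eta\rangle(s,t)=0$ for all $(s,t)\in J\times I$; put $\mu_x=x\wedge\eta$. For $\alpha\in[0,\pi)$, a map $e[\alpha]:U\to J\times I$, $e[\alpha](u)=(s(u),t(u))$, is a pre-$\alpha$-enveloid of $x$, and $E[\alpha]=x\circ e[\alpha]$ is an $\alpha$-enveloid of $x$, if (1) $t:U\to I$ is surjective and non-constant on every non-trivial subinterval of $U$; (2) $\dot E[\alpha](u)$ and $(\cos\alpha)\,\mu_x(e[\alpha](u))+(\sin\alpha)\,\eta(e[\alpha](u))$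 are parallel (linearly dependent) for all $u\in U$. Horocyclic parallel: $P^\pm(\gamma,\lambda_\pm)=\gamma+\lambda_\pm\nu+\frac{\lambda_\pm^2}{2}(\gamma\pm\mu)$ for $\lambda_\pm$ as in the claim. Indefinite integrals denote fixed antiderivatives on $I$, and $c$ is such that the denominator does not vanish on $I$. $E_N^\pm[\pi/2]$ denotes $x_N^\pm\circ e_N^\pm[\pi/2]$. *)

theory Defs
  imports "HOL-Analysis.Analysis"
begin

text \<open>Derivatives are one-sided at end points, so an interval has to have more than one point.\<close>

definition nontrivial_interval :: "real set \<Rightarrow> bool" where
  "nontrivial_interval I \<longleftrightarrow> is_interval I \<and> (\<exists>a\<in>I. \<exists>b\<in>I. a < b)"

text \<open>\<open>C\<^sup>k\<close> maps, with derivatives taken within the domain. The domains below are nontrivial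
  intervals and products of two of them (possibly with end points), on which the derivative within
  the domain is unique. \<open>C\<^sup>k\<^sup>+\<^sup>1\<close> means: differentiable with all directional derivatives \<open>C\<^sup>k\<close>.\<close>

primrec Ck_on :: "nat \<Rightarrow> 'a::real_normed_vector set \<Rightarrow> ('a \<Rightarrow> 'b::real_normed_vector) \<Rightarrow> bool" where
  "Ck_on 0 S f \<longleftrightarrow> continuous_on S f"
| "Ck_on (Suc k) S f \<longleftrightarrow>
     (\<exists>f'. (\<forall>x\<in>S. (f has_derivative f' x) (at x within S)) \<and> (\<forall>v. Ck_on k S (\<lambda>x. f' x v)))"

definition smooth_on :: "'a::real_normed_vector set \<Rightarrow> ('a \<Rightarrow> 'b::real_normed_vector) \<Rightarrow> bool" where
  "smooth_on S f \<longleftrightarrow> (\<forall>k. Ck_on k S f)"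

definition lorentz :: "real^3 \<Rightarrow> real^3 \<Rightarrow> real" where
  "lorentz x y = - (x$1 * y$1) + x$2 * y$2 + x$3 * y$3"

definition wedge :: "real^3 \<Rightarrow> real^3 \<Rightarrow> real^3" where
  "wedge x y = vector [- (x$2 * y$3 - x$3 * y$2), x$3 * y$1 - x$1 * y$3, x$1 * y$2 - x$2 * y$1]"

definition hyperbolic_plane :: "(real^3) set" where
  "hyperbolic_plane = {x. lorentz x x = -1 \<and> x$1 > 0}"

definition de_Sitter :: "(real^3) set" where
  "de_Sitter = {x. lorentz x x = 1}"

definition Delta1 :: "((real^3) \<times> (real^3)) set" where
  "Delta1 = {(v, w). v \<in> hyperbolic_plane \<and> w \<in> de_Sitter \<and> lorentz v w = 0}"

definition spacelike_legendre_curve ::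
    "real set \<Rightarrow> (real \<Rightarrow> real^3) \<Rightarrow> (real \<Rightarrow> real^3) \<Rightarrow> bool" where
  "spacelike_legendre_curve I \<gamma> \<nu> \<longleftrightarrow>
     nontrivial_interval I \<and> smooth_on I \<gamma> \<and> smooth_on I \<nu> \<and>
     (\<forall>t\<in>I. (\<gamma> t, \<nu> t) \<in> Delta1) \<and>
     (\<forall>t\<in>I. lorentz (vector_derivative \<gamma> (at t within I)) (\<nu> t) = 0)"

definition has_legendre_curvature ::
    "real set \<Rightarrow> (real \<Rightarrow> real^3) \<Rightarrow> (real \<Rightarrow> real^3) \<Rightarrow> (real \<Rightarrow> real) \<Rightarrow> (real \<Rightarrow> real) \<Rightarrow> bool" where
  "has_legendre_curvature I \<gamma> \<nu> m n \<longleftrightarrow>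
     (\<forall>t\<in>I. (\<gamma> has_vector_derivative m t *\<^sub>R wedge (\<gamma> t) (\<nu> t)) (at t within I) \<and>
            (\<nu> has_vector_derivative n t *\<^sub>R wedge (\<gamma> t) (\<nu> t)) (at t within I))"

definition legendre_family ::
    "real set \<Rightarrow> real set \<Rightarrow> (real \<times> real \<Rightarrow> real^3) \<Rightarrow> (real \<times> real \<Rightarrow> real^3) \<Rightarrow> bool" where
  "legendre_family J I x \<eta> \<longleftrightarrow>
     nontrivial_interval J \<and> nontrivial_interval I \<and>
     smooth_on (J \<times> I) x \<and> smooth_on (J \<times> I) \<eta> \<and>
     (\<forall>p\<in>J \<times> I. (x p, \<eta> p) \<in> Delta1) \<and>
     (\<forall>s\<in>J. \<forall>t\<in>I. lorentz (vector_derivative (\<lambda>r. x (r, t)) (at s within J)) (\<eta> (s, t)) = 0)"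

definition lin_dependent :: "real^3 \<Rightarrow> real^3 \<Rightarrow> bool" where
  "lin_dependent v w \<longleftrightarrow> (\<exists>a b. (a, b) \<noteq> (0, 0) \<and> a *\<^sub>R v + b *\<^sub>R w = 0)"

definition pre_enveloid ::
    "real \<Rightarrow> real set \<Rightarrow> real set \<Rightarrow> (real \<times> real \<Rightarrow> real^3) \<Rightarrow> (real \<times> real \<Rightarrow> real^3) \<Rightarrow>
     real set \<Rightarrow> (real \<Rightarrow> real \<times> real) \<Rightarrow> bool" where
  "pre_enveloid \<alpha> J I x \<eta> U e \<longleftrightarrow>
     \<alpha> \<in> {0..<pi} \<and> legendre_family J I x \<eta> \<and> nontrivial_interval U \<and>
     smooth_on U e \<and> e ` U \<subseteq> J \<times> I \<and>
     (snd \<circ> e) ` U = I \<and>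
     (\<forall>V. V \<subseteq> U \<and> nontrivial_interval V \<longrightarrow> \<not> (snd \<circ> e) constant_on V) \<and>
     (\<forall>u\<in>U. lin_dependent (vector_derivative (x \<circ> e) (at u within U))
              (cos \<alpha> *\<^sub>R wedge (x (e u)) (\<eta> (e u)) + sin \<alpha> *\<^sub>R \<eta> (e u)))"

definition enveloid ::
    "real \<Rightarrow> real set \<Rightarrow> real set \<Rightarrow> (real \<times> real \<Rightarrow> real^3) \<Rightarrow> (real \<times> real \<Rightarrow> real^3) \<Rightarrow>
     real set \<Rightarrow> (real \<Rightarrow> real^3) \<Rightarrow> bool" where
  "enveloid \<alpha> J I x \<eta> U E \<longleftrightarrow>
     (\<exists>e. pre_enveloid \<alpha> J I x \<eta> U e \<and> (\<forall>u\<in>U. E u = (x \<circ> e) u))"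

text \<open>The sign \<open>\<sigma>\<close> is \<open>1\<close> or \<open>-1\<close> and encodes the upper or the lower signs: \<open>\<plusminus>\<close> is \<open>\<sigma>\<close> and
  \<open>\<mp>\<close> is \<open>-\<sigma>\<close>.\<close>

definition x_N :: "real \<Rightarrow> (real \<Rightarrow> real^3) \<Rightarrow> (real \<Rightarrow> real^3) \<Rightarrow> real \<times> real \<Rightarrow> real^3" where
  "x_N \<sigma> \<gamma> \<nu> = (\<lambda>(s, t).
     \<gamma> t + s *\<^sub>R \<nu> t + (s\<^sup>2 / 2) *\<^sub>R (\<gamma> t + \<sigma> *\<^sub>R wedge (\<gamma> t) (\<nu> t)))"

definition nu_N :: "real \<Rightarrow> (real \<Rightarrow> real^3) \<Rightarrow> (real \<Rightarrow> real^3) \<Rightarrow> real \<times> real \<Rightarrow> real^3" where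
  "nu_N \<sigma> \<gamma> \<nu> = (\<lambda>(s, t).
     (- \<sigma>) *\<^sub>R wedge (\<gamma> t) (\<nu> t) + s *\<^sub>R \<nu> t
     + (s\<^sup>2 / 2) *\<^sub>R (\<gamma> t + \<sigma> *\<^sub>R wedge (\<gamma> t) (\<nu> t)))"

definition horocyclic_parallel ::
    "real \<Rightarrow> (real \<Rightarrow> real^3) \<Rightarrow> (real \<Rightarrow> real^3) \<Rightarrow> (real \<Rightarrow> real) \<Rightarrow> real \<Rightarrow> real^3" where
  "horocyclic_parallel \<sigma> \<gamma> \<nu> lam t =
     \<gamma> t + lam t *\<^sub>R \<nu> t + ((lam t)\<^sup>2 / 2) *\<^sub>R (\<gamma> t + \<sigma> *\<^sub>R wedge (\<gamma> t) (\<nu> t))"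

definition horocyclic_solution ::
    "real \<Rightarrow> real set \<Rightarrow> (real \<Rightarrow> real) \<Rightarrow> (real \<Rightarrow> real) \<Rightarrow> (real \<Rightarrow> real) \<Rightarrow> bool" where
  "horocyclic_solution \<sigma> I m n lam \<longleftrightarrow>
     smooth_on I lam \<and>
     (\<forall>t\<in>I. (lam has_real_derivative - \<sigma> * ((lam t)\<^sup>2 * n t / 2 + lam t * m t)) (at t within I))"

definition antiderivative_on :: "real set \<Rightarrow> (real \<Rightarrow> real) \<Rightarrow> (real \<Rightarrow> real) \<Rightarrow> bool" where
  "antiderivative_on I f F \<longleftrightarrow> (\<forall>t\<in>I. (F has_real_derivative f t) (at t within I))"

end

theory Submission
  imports Defs
begin

text \<open>In the frame \<open>\<gamma>, \<nu>, \<mu>\<close>, where \<open>\<mu>' = m \<gamma> - n \<nu>\<close>, the Riccati equation for \<open>lam\<close> is what turns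
  the derivative of \<open>t \<mapsto> x_N (lam t, t)\<close> into the multiple \<open>- \<sigma> (m + lam n)\<close> of \<open>nu_N (lam t, t)\<close>.
  The Riccati equation itself becomes \<open>(e\<^sup>A / lam)' = \<sigma> B' / 2\<close> as long as \<open>lam\<close> has no zero.\<close>

section \<open>Closure properties of smooth maps\<close>

text \<open>Lowering the order lets a product rule keep one undifferentiated factor beside a
  derivative of the other. The content lies in the base case, where differentiability gives
  continuity; the step passes to the directional derivatives.\<close>

lemma Ck_on_SucD: "Ck_on (Suc k) S f \<Longrightarrow> Ck_on k S f"
proof (induction k arbitrary: f)
  case 0
  then show ?case
    by (auto simp: continuous_on_eq_continuous_within intro: has_derivative_continuous)
next
  case (Suc k)
  then obtain f' where f: "\<forall>x\<in>S. (f has_derivative f' x) (at x within S)"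
    and "\<And>v. Ck_on (Suc k) S (\<lambda>x. f' x v)"
    by (subst (asm) Ck_on.simps) blast
  then have "\<And>v. Ck_on k S (\<lambda>x. f' x v)"
    by (intro Suc.IH)
  with f show ?case
    by auto
qed

lemma Ck_on_cong:
  assumes "Ck_on k S f" and "\<And>x. x \<in> S \<Longrightarrow> g x = f x"
  shows "Ck_on k S g"
proof (cases k)
  case 0
  then show ?thesis
    using assms continuous_on_cong[of S S g f] by auto
next
  case (Suc j)
  with assms(1) obtain f' where f: "\<And>x. x \<in> S \<Longrightarrow> (f has_derivative f' x) (at x within S)"
    and f': "\<And>v. Ck_on j S (\<lambda>x. f' x v)"
    by auto
  have "(g has_derivative f' x) (at x within S)" if "x \<in> S" for x
    using has_derivative_transform[OF that assms(2) f[OF that]] .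
  with f' Suc show ?thesis
    by auto
qed

lemma smooth_on_cong:
  "smooth_on S f \<Longrightarrow> (\<And>x. x \<in> S \<Longrightarrow> g x = f x) \<Longrightarrow> smooth_on S g"
  unfolding smooth_on_def using Ck_on_cong by metis

lemma smooth_on_imp_continuous_on: "smooth_on S f \<Longrightarrow> continuous_on S f"
  unfolding smooth_on_def by (metis Ck_on.simps(1))

lemma Ck_on_const: "Ck_on k S (\<lambda>x. c)"
proof (induction k arbitrary: c)
  case (Suc k)
  then show ?case
    by (auto intro!: exI[of _ "\<lambda>x v. 0"])
qed simp

lemma smooth_on_const: "smooth_on S (\<lambda>x. c)"
  by (simp add: smooth_on_def Ck_on_const)

lemma smooth_on_bounded_linear: "bounded_linear L \<Longrightarrow> smooth_on S L"
  unfolding smooth_on_def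
proof
  fix k
  assume L: "bounded_linear L"
  show "Ck_on k S L"
  proof (cases k)
    case 0
    then show ?thesis
      by (simp add: L linear_continuous_on)
  next
    case (Suc j)
    then show ?thesis
      using L by (auto intro!: exI[of _ "\<lambda>x. L"] bounded_linear_imp_has_derivative Ck_on_const)
  qed
qed

lemma Ck_on_add:
  "Ck_on k S f \<Longrightarrow> Ck_on k S g \<Longrightarrow> Ck_on k S (\<lambda>x. f x + g x)"
proof (induction k arbitrary: f g)
  case 0
  then show ?case
    by (auto intro: continuous_on_add)
next
  case (Suc k)
  from Suc.prems(1) obtain f' where f: "\<forall>x\<in>S. (f has_derivative f' x) (at x within S)"
    and f': "\<And>v. Ck_on k S (\<lambda>x. f' x v)"
    by auto
  from Suc.prems(2) obtain g' where g: "\<forall>x\<in>S. (g has_derivative g' x) (at x within S)"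
    and g': "\<And>v. Ck_on k S (\<lambda>x. g' x v)"
    by auto
  show ?case
    using f g Suc.IH[OF f' g']
    by (auto intro!: exI[of _ "\<lambda>x v. f' x v + g' x v"] has_derivative_add)
qed

lemma smooth_on_add:
  "smooth_on S f \<Longrightarrow> smooth_on S g \<Longrightarrow> smooth_on S (\<lambda>x. f x + g x)"
  by (simp add: smooth_on_def Ck_on_add)

text \<open>One Leibniz rule serves \<open>scaleR\<close>, multiplication, \<open>wedge\<close> and
  \<open>lorentz\<close> alike. Each derivative term pairs a directional derivative with an original
  factor whose order is lowered by \<open>Ck_on_SucD\<close>.\<close>

lemma (in bounded_bilinear) Ck_on:
  "Ck_on k S f \<Longrightarrow> Ck_on k S g \<Longrightarrow> Ck_on k S (\<lambda>x. prod (f x) (g x))"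
proof (induction k arbitrary: f g)
  case 0
  then show ?case
    by (auto intro: continuous_on)
next
  case (Suc k)
  from Suc.prems(1) obtain f' where f: "\<forall>x\<in>S. (f has_derivative f' x) (at x within S)"
    and f': "\<And>v. Ck_on k S (\<lambda>x. f' x v)"
    by auto
  from Suc.prems(2) obtain g' where g: "\<forall>x\<in>S. (g has_derivative g' x) (at x within S)"
    and g': "\<And>v. Ck_on k S (\<lambda>x. g' x v)"
    by auto
  have "Ck_on k S (\<lambda>x. prod (f x) (g' x v) + prod (f' x v) (g x))" for v
    by (intro Ck_on_add Suc.IH Ck_on_SucD[OF Suc.prems(1)] Ck_on_SucD[OF Suc.prems(2)] f' g')
  with f g show ?case
    by (auto intro!: exI[of _ "\<lambda>x v. prod (f x) (g' x v) + prod (f' x v) (g x)"] FDERIV)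
qed

lemma (in bounded_bilinear) smooth_on:
  "smooth_on S f \<Longrightarrow> smooth_on S g \<Longrightarrow> smooth_on S (\<lambda>x. prod (f x) (g x))"
  by (simp add: smooth_on_def Ck_on)

lemmas smooth_on_scaleR = bounded_bilinear.smooth_on[OF bounded_bilinear_scaleR]
lemmas smooth_on_mult = bounded_bilinear.smooth_on[OF bounded_bilinear_mult]

text \<open>For a linear inner map the derivative in direction \<open>v\<close> is
  \<open>f' (L x) (L v)\<close>, where \<open>L v\<close> does not depend on \<open>x\<close>. It is
  again a function composed with \<open>L\<close>, so the induction closes. The projection
  \<open>snd\<close> is the case used below.\<close>

lemma Ck_on_compose_linear:
  assumes L: "bounded_linear L" and LS: "L ` S \<subseteq> T"
  shows "Ck_on k T f \<Longrightarrow> Ck_on k S (\<lambda>x. f (L x))"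
proof (induction k arbitrary: f)
  case 0
  then show ?case
    using continuous_on_compose2[OF _ linear_continuous_on[OF L] LS] by simp
next
  case (Suc k)
  then obtain f' where f: "\<forall>x\<in>T. (f has_derivative f' x) (at x within T)"
    and f': "\<And>v. Ck_on k T (\<lambda>x. f' x v)"
    by auto
  have "((\<lambda>x. f (L x)) has_derivative (\<lambda>v. f' (L x) (L v))) (at x within S)" if "x \<in> S" for x
    using has_derivative_in_compose2[of T f f' L S x L] f LS that
      bounded_linear_imp_has_derivative[OF L] by blast
  with Suc.IH[OF f'] show ?case
    by (auto intro!: exI[of _ "\<lambda>x v. f' (L x) (L v)"])
qed

lemma smooth_on_compose_linear:
  "bounded_linear L \<Longrightarrow> L ` S \<subseteq> T \<Longrightarrow> smooth_on T f \<Longrightarrow> smooth_on S (\<lambda>x. f (L x))"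
  unfolding smooth_on_def using Ck_on_compose_linear by blast

text \<open>Outer composition with \<open>L\<close> is the bilinear product
  \<open>r *\<^sub>R L y\<close> at the constant \<open>r = 1\<close>, so the Leibniz rule covers
  it.\<close>

lemma smooth_on_linear_compose:
  assumes "bounded_linear L" and "smooth_on S f"
  shows "smooth_on S (\<lambda>x. L (f x))"
proof -
  have bb: "bounded_bilinear (\<lambda>y (r::real). r *\<^sub>R L y)"
    by (rule bounded_bilinear.comp1[OF bounded_bilinear.flip[OF bounded_bilinear_scaleR] assms(1)])
  show ?thesis
    using bounded_bilinear.smooth_on[OF bb assms(2) smooth_on_const[of S 1]] by simp
qed

lemma smooth_on_Pair:
  assumes "smooth_on S f" and "smooth_on S g"
  shows "smooth_on S (\<lambda>x. (f x, g x))"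
proof -
  have "smooth_on S (\<lambda>x. (f x, 0) + (0, g x))"
    using assms by (intro smooth_on_add smooth_on_linear_compose[of "\<lambda>y. (y, 0)"]
        smooth_on_linear_compose[of "\<lambda>y. (0, y)"] bounded_linear_Pair
        bounded_linear_ident bounded_linear_zero)
  then show ?thesis
    by simp
qed

text \<open>The derivative contains \<open>exp (f x)\<close> itself, so induction on the order with
  \<open>f\<close> fixed suffices. The same device works for \<open>inverse\<close> below.\<close>

lemma smooth_on_exp:
  fixes f :: "'a::real_normed_vector \<Rightarrow> real"
  assumes "smooth_on S f"
  shows "smooth_on S (\<lambda>x. exp (f x))"
  unfolding smooth_on_def
proof
  fix k
  show "Ck_on k S (\<lambda>x. exp (f x))"
  proof (induction k)
    case 0
    then show ?case
      using smooth_on_imp_continuous_on[OF assms] by (auto intro: continuous_on_exp)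
  next
    case (Suc k)
    from assms have "Ck_on (Suc k) S f"
      by (simp add: smooth_on_def)
    then obtain f' where f: "\<forall>x\<in>S. (f has_derivative f' x) (at x within S)"
      and f': "\<And>v. Ck_on k S (\<lambda>x. f' x v)"
      by auto
    have "Ck_on k S (\<lambda>x. f' x v * exp (f x))" for v
      by (rule bounded_bilinear.Ck_on[OF bounded_bilinear_mult f' Suc.IH])
    with f show ?case
      by (auto intro!: exI[of _ "\<lambda>x v. f' x v * exp (f x)"] derivative_eq_intros)
  qed
qed

lemma smooth_on_inverse:
  fixes f :: "'a::real_normed_vector \<Rightarrow> real"
  assumes "smooth_on S f" and nz: "\<And>x. x \<in> S \<Longrightarrow> f x \<noteq> 0"
  shows "smooth_on S (\<lambda>x. inverse (f x))"
  unfolding smooth_on_def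
proof
  fix k
  show "Ck_on k S (\<lambda>x. inverse (f x))"
  proof (induction k)
    case 0
    then show ?case
      using smooth_on_imp_continuous_on[OF assms(1)] nz by (auto intro: continuous_on_inverse)
  next
    case (Suc k)
    from assms have "Ck_on (Suc k) S f"
      by (simp add: smooth_on_def)
    then obtain f' where f: "\<forall>x\<in>S. (f has_derivative f' x) (at x within S)"
      and f': "\<And>v. Ck_on k S (\<lambda>x. f' x v)"
      by auto
    \<comment> \<open>The minus sign is written as a constant factor so that the product rule alone
      applies.\<close>
    have "Ck_on k S (\<lambda>x. (-1) * (inverse (f x) * f' x v * inverse (f x)))" for v
      by (intro bounded_bilinear.Ck_on[OF bounded_bilinear_mult] Ck_on_const f' Suc.IH)
    with f nz show ?case
      by (auto intro!: exI[of _ "\<lambda>x v. - (inverse (f x) * f' x v * inverse (f x))"]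
          has_derivative_inverse)
  qed
qed

section \<open>Smooth maps on an interval\<close>

text \<open>A connected set with more than one point has no isolated points; hence derivatives
  within \<open>I\<close> are unique, also at end points.\<close>

lemma nontrivial_interval_at_within_neq_bot:
  assumes "nontrivial_interval I" and "t \<in> I"
  shows "at t within I \<noteq> bot"
proof -
  have "connected I" and "I \<noteq> {x}" for x
    using assms by (auto simp: nontrivial_interval_def is_interval_connected)
  then show ?thesis
    using connected_imp_perfect[of I t] assms(2) by (simp add: trivial_limit_within)
qed

lemma smooth_on_has_vector_derivative:
  fixes f :: "real \<Rightarrow> 'b::real_normed_vector"
  assumes "\<And>t. t \<in> I \<Longrightarrow> (f has_vector_derivative f' t) (at t within I)" and "smooth_on I f'"
  shows "smooth_on I f"
  unfolding smooth_on_def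
proof
  fix k
  have "Ck_on (Suc k) I f"
    using assms smooth_on_scaleR[OF smooth_on_const assms(2)]
    by (auto intro!: exI[of _ "\<lambda>t v. v *\<^sub>R f' t"] simp: has_vector_derivative_def smooth_on_def)
  then show "Ck_on k I f"
    by (rule Ck_on_SucD)
qed

text \<open>\<open>Ck_on\<close> only provides some derivative \<open>D\<close>. By uniqueness of
  derivatives within \<open>I\<close>, \<open>f'\<close> is its value in direction 1 and inherits
  the smoothness.\<close>

lemma smooth_on_vector_derivative:
  fixes f :: "real \<Rightarrow> 'b::real_normed_vector"
  assumes "nontrivial_interval I" and "smooth_on I f"
    and f': "\<And>t. t \<in> I \<Longrightarrow> (f has_vector_derivative f' t) (at t within I)"
  shows "smooth_on I f'"
  unfolding smooth_on_def
proof
  fix k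
  from assms(2) have "Ck_on (Suc k) I f"
    by (simp add: smooth_on_def)
  then obtain D where D: "\<forall>t\<in>I. (f has_derivative D t) (at t within I)"
    and D1: "\<And>v. Ck_on k I (\<lambda>t. D t v)"
    by auto
  have "f' t = D t 1" if "t \<in> I" for t
  proof -
    have Dt: "(f has_derivative D t) (at t within I)"
      using D that by blast
    have "D t x = x *\<^sub>R D t 1" for x
      using linear_scale[OF has_derivative_linear[OF Dt], of x 1] by simp
    then have "(\<lambda>x. x *\<^sub>R D t 1) = D t"
      by (intro ext) (rule sym)
    with Dt have "(f has_vector_derivative D t 1) (at t within I)"
      by (simp only: has_vector_derivative_def)
    note vector_derivative_within[OF nontrivial_interval_at_within_neq_bot[OF assms(1) that] this]
    moreover note
      vector_derivative_within[OF nontrivial_interval_at_within_neq_bot[OF assms(1) that] f'[OF that]]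
    ultimately show ?thesis
      by simp
  qed
  then show "Ck_on k I f'"
    by (intro Ck_on_cong[OF D1])
qed

text \<open>Integrating factor: if \<open>G\<close> is an antiderivative of \<open>g\<close>, then
  \<open>z * exp (- G)\<close> is constant, and it vanishes at \<open>r\<close>.\<close>

lemma linear_ode_zero_unique:
  fixes z g :: "real \<Rightarrow> real"
  assumes "is_interval I" and g: "continuous_on I g"
    and z: "\<And>t. t \<in> I \<Longrightarrow> (z has_real_derivative g t * z t) (at t within I)"
    and "r \<in> I" and "z r = 0" and "t \<in> I"
  shows "z t = 0"
proof -
  \<comment> \<open>Only the compact interval between \<open>r\<close> and \<open>t\<close> matters.
    It lies in \<open>I\<close>, and there the integral from its left end point is an antiderivative
    of \<open>g\<close>.\<close>
  define a b where "a = min r t" and "b = max r t"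
  have "a \<in> I" and "b \<in> I" and ab: "r \<in> {a..b}" "t \<in> {a..b}"
    using assms(4,6) by (auto simp: a_def b_def min_def max_def)
  then have abI: "{a..b} \<subseteq> I"
    using assms(1) by (meson atLeastAtMost_iff is_interval_1 subsetI)
  define G where "G = (\<lambda>u. integral {a..u} g)"
  have G: "(G has_real_derivative g u) (at u within {a..b})" if "u \<in> {a..b}" for u
    unfolding G_def has_real_derivative_iff_has_vector_derivative
    by (rule integral_has_vector_derivative[OF continuous_on_subset[OF g abI] that])
  have z': "(z has_real_derivative g u * z u) (at u within {a..b})" if "u \<in> {a..b}" for u
    using DERIV_subset[OF z abI] abI that by blast
  have "((\<lambda>u. z u * exp (- G u)) has_real_derivative 0) (at u within {a..b})"
    if "u \<in> {a..b}" for u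
    by (rule derivative_eq_intros z' G that refl)+ simp
  then obtain c where c: "\<And>u. u \<in> {a..b} \<Longrightarrow> z u * exp (- G u) = c"
    using has_field_derivative_zero_constant[OF convex_real_interval(5), of a b "\<lambda>u. z u * exp (- G u)"]
    by blast
  from c[OF ab(1)] c[OF ab(2)] show ?thesis
    using assms(5) by simp
qed

section \<open>Lorentzian algebra\<close>

lemma wedge_nth:
  "wedge x y $ 1 = - (x$2 * y$3 - x$3 * y$2)"
  "wedge x y $ 2 = x$3 * y$1 - x$1 * y$3"
  "wedge x y $ 3 = x$1 * y$2 - x$2 * y$1"
  by (simp_all add: wedge_def)

lemma bounded_bilinear_wedge: "bounded_bilinear wedge"
  unfolding bilinear_conv_bounded_bilinear[symmetric] bilinear_def
  by (auto intro!: linearI simp: vec_eq_iff forall_3 wedge_nth algebra_simps)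

lemma bounded_bilinear_lorentz: "bounded_bilinear lorentz"
  unfolding bilinear_conv_bounded_bilinear[symmetric] bilinear_def
  by (auto intro!: linearI simp: lorentz_def algebra_simps)

lemmas lorentz_simps =
  bounded_bilinear.add_left[OF bounded_bilinear_lorentz]
  bounded_bilinear.add_right[OF bounded_bilinear_lorentz]
  bounded_bilinear.diff_left[OF bounded_bilinear_lorentz]
  bounded_bilinear.diff_right[OF bounded_bilinear_lorentz]
  bounded_bilinear.minus_left[OF bounded_bilinear_lorentz]
  bounded_bilinear.minus_right[OF bounded_bilinear_lorentz]
  bounded_bilinear.scaleR_left[OF bounded_bilinear_lorentz]
  bounded_bilinear.scaleR_right[OF bounded_bilinear_lorentz]

lemma lorentz_commute: "lorentz x y = lorentz y x"
  by (simp add: lorentz_def algebra_simps)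

lemma lorentz_wedge_self: "lorentz x (wedge x y) = 0" "lorentz y (wedge x y) = 0"
  by (simp_all add: lorentz_def wedge_nth algebra_simps)

lemma lorentz_wedge_wedge:
  "lorentz (wedge x y) (wedge x y) = (lorentz x y)\<^sup>2 - lorentz x x * lorentz y y"
  by (simp add: lorentz_def wedge_nth power2_eq_square algebra_simps)

text \<open>With the next lemma, these Lorentzian triple product formulas give \<mu> \<and> \<nu> =
  \<gamma> and \<gamma> \<and> \<mu> = -\<nu> on \<open>Delta1\<close>, with \<and> standing for
  \<open>wedge\<close>.\<close>

lemma wedge_wedge_left: "wedge (wedge x y) y = lorentz y y *\<^sub>R x - lorentz x y *\<^sub>R y"
  by (simp add: vec_eq_iff forall_3 wedge_nth lorentz_def algebra_simps)

lemma wedge_wedge_right: "wedge x (wedge x y) = lorentz x x *\<^sub>R y - lorentz x y *\<^sub>R x"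
  by (simp add: vec_eq_iff forall_3 wedge_nth lorentz_def algebra_simps)

text \<open>Reversed Cauchy-Schwarz: timelike unit vectors on opposite sheets have a positive
  product, so a negative product excludes \<open>y$1 \<le> 0\<close>.\<close>

lemma hyperbolic_plane_same_sheet:
  assumes "x \<in> hyperbolic_plane" and y: "lorentz y y = -1" and "lorentz x y < 0"
  shows "y \<in> hyperbolic_plane"
proof (rule ccontr)
  assume "y \<notin> hyperbolic_plane"
  then have "y$1 \<le> 0"
    using y by (auto simp: hyperbolic_plane_def)
  have x: "x$1 > 0" "(x$1)\<^sup>2 = 1 + (x$2)\<^sup>2 + (x$3)\<^sup>2"
    and y2: "(y$1)\<^sup>2 = 1 + (y$2)\<^sup>2 + (y$3)\<^sup>2"
    using assms(1) y by (auto simp: hyperbolic_plane_def lorentz_def power2_eq_square)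
  have "0 \<le> x$1 * - y$1"
    using x(1) \<open>y$1 \<le> 0\<close> by (simp add: mult_nonneg_nonpos)
  moreover have "x$1 * - y$1 < - (x$2 * y$2 + x$3 * y$3)"
    using assms(3) by (simp add: lorentz_def)
  ultimately have "(x$1 * - y$1)\<^sup>2 < (- (x$2 * y$2 + x$3 * y$3))\<^sup>2"
    by (intro power_strict_mono) auto
  \<comment> \<open>After inserting the norm conditions, Lagrange's identity for the last two
    coordinates turns the difference into a sum of squares, contradicting the strict
    inequality.\<close>
  moreover have "(x$1 * - y$1)\<^sup>2 - (- (x$2 * y$2 + x$3 * y$3))\<^sup>2
      = 1 + (x$2)\<^sup>2 + (x$3)\<^sup>2 + (y$2)\<^sup>2 + (y$3)\<^sup>2 + (x$2 * y$3 - x$3 * y$2)\<^sup>2"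
    unfolding power_mult_distrib power2_minus x(2) y2
    by (simp add: power2_eq_square algebra_simps)
  moreover have "\<dots> \<ge> 0"
    by simp
  ultimately show False
    by linarith
qed

text \<open>The Gram matrix of the frame. Both orders of each mixed product are listed, so that with
  \<open>lorentz_simps\<close> any product of two combinations of the frame can be
  evaluated.\<close>

lemma Delta1_frame:
  assumes "(g, v) \<in> Delta1"
  shows "lorentz g g = -1" "lorentz v v = 1" "lorentz (wedge g v) (wedge g v) = 1"
    "lorentz g v = 0" "lorentz v g = 0"
    "lorentz g (wedge g v) = 0" "lorentz (wedge g v) g = 0"
    "lorentz v (wedge g v) = 0" "lorentz (wedge g v) v = 0"
  using assms lorentz_commute
  by (auto simp: Delta1_def hyperbolic_plane_def de_Sitter_def lorentz_wedge_self
      lorentz_wedge_wedge)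

text \<open>The vector \<open>w\<close> is null, orthogonal to \<open>v\<close>, and has product -1
  with \<open>g\<close>; this uses \<sigma>^2 = 1. Write x and y for the two components of the pair.
  Then y = x - w and <x, w> = -1, so <x, x> = -1 yields <y, y> = 1 and <x, y> = 0. The tangent
  \<open>v + s *\<^sub>R w\<close> is orthogonal to both x and \<open>w\<close>, hence to y.\<close>

lemma horocycle_frame:
  assumes gv: "(g, v) \<in> Delta1" and \<sigma>: "\<sigma> = 1 \<or> \<sigma> = -1"
  defines "w \<equiv> g + \<sigma> *\<^sub>R wedge g v"
  shows "(g + s *\<^sub>R v + (s\<^sup>2 / 2) *\<^sub>R w,
      (- \<sigma>) *\<^sub>R wedge g v + s *\<^sub>R v + (s\<^sup>2 / 2) *\<^sub>R w) \<in> Delta1"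
    and "lorentz (v + s *\<^sub>R w) ((- \<sigma>) *\<^sub>R wedge g v + s *\<^sub>R v + (s\<^sup>2 / 2) *\<^sub>R w) = 0"
proof -
  note simps = w_def lorentz_simps Delta1_frame[OF gv] power2_eq_square field_simps
  let ?x = "g + s *\<^sub>R v + (s\<^sup>2 / 2) *\<^sub>R w"
  let ?y = "(- \<sigma>) *\<^sub>R wedge g v + s *\<^sub>R v + (s\<^sup>2 / 2) *\<^sub>R w"
  \<comment> \<open>This negative product with \<open>g\<close> places \<open>?x\<close> on the
    sheet containing \<open>g\<close>.\<close>
  have "lorentz g ?x = - 1 - s\<^sup>2 / 2"
    using \<sigma> by (auto simp: simps)
  moreover have "- 1 - s\<^sup>2 / 2 < 0"
    using zero_le_power2[of s] by linarith
  moreover have "lorentz ?x ?x = -1"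
    using \<sigma> by (auto simp: simps)
  moreover have "g \<in> hyperbolic_plane"
    using gv by (simp add: Delta1_def)
  ultimately have "?x \<in> hyperbolic_plane"
    using hyperbolic_plane_same_sheet by metis
  moreover have "lorentz ?y ?y = 1" "lorentz ?x ?y = 0"
    using \<sigma> by (auto simp: simps)
  ultimately show "(?x, ?y) \<in> Delta1"
    by (simp add: Delta1_def de_Sitter_def)
  show "lorentz (v + s *\<^sub>R w) ?y = 0"
    using \<sigma> by (auto simp: simps)
qed

section \<open>Horocyclic parallels\<close>

lemma legendre_family_x_N:
  assumes "spacelike_legendre_curve I \<gamma> \<nu>" and \<sigma>: "\<sigma> = 1 \<or> \<sigma> = -1"
  shows "legendre_family UNIV I (x_N \<sigma> \<gamma> \<nu>) (nu_N \<sigma> \<gamma> \<nu>)"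
proof -
  from assms(1) have I: "nontrivial_interval I" and "smooth_on I \<gamma>" and "smooth_on I \<nu>"
    and D: "\<And>t. t \<in> I \<Longrightarrow> (\<gamma> t, \<nu> t) \<in> Delta1"
    by (auto simp: spacelike_legendre_curve_def)
  let ?S = "(UNIV :: real set) \<times> I"
  have \<gamma>: "smooth_on ?S (\<lambda>p. \<gamma> (snd p))" and \<nu>: "smooth_on ?S (\<lambda>p. \<nu> (snd p))"
    using smooth_on_compose_linear[OF bounded_linear_snd, of ?S I] \<open>smooth_on I \<gamma>\<close> \<open>smooth_on I \<nu>\<close>
    by auto
  have s: "smooth_on ?S (\<lambda>p. fst p)"
    by (rule smooth_on_bounded_linear[OF bounded_linear_fst])
  note \<mu> = bounded_bilinear.smooth_on[OF bounded_bilinear_wedge \<gamma> \<nu>]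
  note intros = \<gamma> \<nu> s \<mu> smooth_on_add smooth_on_scaleR smooth_on_mult smooth_on_const
  \<comment> \<open>The square is spelled out as a product to match the closure rules.\<close>
  have "smooth_on ?S (\<lambda>p. \<gamma> (snd p) + fst p *\<^sub>R \<nu> (snd p)
      + (1/2 * (fst p * fst p)) *\<^sub>R (\<gamma> (snd p) + \<sigma> *\<^sub>R wedge (\<gamma> (snd p)) (\<nu> (snd p))))"
    by (intro intros)
  then have x: "smooth_on ?S (x_N \<sigma> \<gamma> \<nu>)"
    by (simp add: x_N_def case_prod_beta' power2_eq_square)
  have "smooth_on ?S (\<lambda>p. (- \<sigma>) *\<^sub>R wedge (\<gamma> (snd p)) (\<nu> (snd p)) + fst p *\<^sub>R \<nu> (snd p)
      + (1/2 * (fst p * fst p)) *\<^sub>R (\<gamma> (snd p) + \<sigma> *\<^sub>R wedge (\<gamma> (snd p)) (\<nu> (snd p))))"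
    by (intro intros)
  then have \<eta>: "smooth_on ?S (nu_N \<sigma> \<gamma> \<nu>)"
    by (simp add: nu_N_def case_prod_beta' power2_eq_square)
  \<comment> \<open>The parameter \<open>s\<close> ranges over the whole line, so the derivative is
    unrestricted; it is the tangent vector treated in \<open>horocycle_frame\<close>.\<close>
  have "((\<lambda>r. x_N \<sigma> \<gamma> \<nu> (r, t)) has_vector_derivative
      \<nu> t + s *\<^sub>R (\<gamma> t + \<sigma> *\<^sub>R wedge (\<gamma> t) (\<nu> t))) (at s)" for s t
    unfolding x_N_def by (auto intro!: derivative_eq_intros)
  then have "vector_derivative (\<lambda>r. x_N \<sigma> \<gamma> \<nu> (r, t)) (at s)
      = \<nu> t + s *\<^sub>R (\<gamma> t + \<sigma> *\<^sub>R wedge (\<gamma> t) (\<nu> t))" for s t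
    by (rule vector_derivative_at)
  then have "lorentz (vector_derivative (\<lambda>r. x_N \<sigma> \<gamma> \<nu> (r, t)) (at s)) (nu_N \<sigma> \<gamma> \<nu> (s, t)) = 0"
    if "t \<in> I" for s t
    using horocycle_frame(2)[OF D[OF that] \<sigma>] by (simp only: nu_N_def prod.case)
  moreover have "(x_N \<sigma> \<gamma> \<nu> p, nu_N \<sigma> \<gamma> \<nu> p) \<in> Delta1" if "p \<in> ?S" for p
    using horocycle_frame(1)[OF D \<sigma>] that by (auto simp only: x_N_def nu_N_def prod.case)
  moreover have "nontrivial_interval (UNIV :: real set)"
    by (auto simp: nontrivial_interval_def intro: exI[of _ "0::real"] exI[of _ "1::real"])
  ultimately show ?thesis
    using x \<eta> I unfolding legendre_family_def by blast
qed

text \<open>Since \<mu> is a unit vector, m = <\<gamma>', \<mu>> and n = <\<nu>', \<mu>>. The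
  curvature is given only through derivatives, while smoothness of \<open>lam\<close> from its
  formula needs \<open>m\<close> and \<open>n\<close> smooth.\<close>

lemma legendre_curvature_smooth:
  assumes "spacelike_legendre_curve I \<gamma> \<nu>" and "has_legendre_curvature I \<gamma> \<nu> m n"
  shows "smooth_on I m" "smooth_on I n"
proof -
  from assms have I: "nontrivial_interval I" and \<gamma>: "smooth_on I \<gamma>" and \<nu>: "smooth_on I \<nu>"
    and D: "\<And>t. t \<in> I \<Longrightarrow> (\<gamma> t, \<nu> t) \<in> Delta1"
    by (auto simp: spacelike_legendre_curve_def)
  have *: "smooth_on I k"
    if "smooth_on I f"
      and "\<And>t. t \<in> I \<Longrightarrow> (f has_vector_derivative k t *\<^sub>R wedge (\<gamma> t) (\<nu> t)) (at t within I)"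
    for f k
  proof (rule smooth_on_cong)
    show "smooth_on I (\<lambda>t. lorentz (k t *\<^sub>R wedge (\<gamma> t) (\<nu> t)) (wedge (\<gamma> t) (\<nu> t)))"
      by (intro bounded_bilinear.smooth_on[OF bounded_bilinear_lorentz]
          bounded_bilinear.smooth_on[OF bounded_bilinear_wedge] \<gamma> \<nu>
          smooth_on_vector_derivative[OF I that])
  qed (simp add: lorentz_simps Delta1_frame[OF D])
  show "smooth_on I m" "smooth_on I n"
    using assms(2) *[OF \<gamma>, of m] *[OF \<nu>, of n] by (auto simp: has_legendre_curvature_def)
qed

text \<open>Along a solution \<open>lam\<close> that is nonzero at \<open>r\<close>, \<open>z = lam e\<^sup>-\<^sup>A (\<sigma> B / 2 + d) - 1\<close>
  satisfies the linear equation \<open>z' = - (\<sigma> n lam / 2) z\<close>, and \<open>d\<close> is chosen so that \<open>z r = 0\<close>.\<close>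

lemma horocyclic_solution_iff:
  assumes I: "nontrivial_interval I" and m: "smooth_on I m" and n: "smooth_on I n"
    and \<sigma>: "\<sigma> = 1 \<or> \<sigma> = -1"
    and "antiderivative_on I (\<lambda>t. - \<sigma> * m t) A"
    and "antiderivative_on I (\<lambda>t. n t * exp (A t)) B"
  shows "horocyclic_solution \<sigma> I m n lam \<longleftrightarrow>
    (\<forall>t\<in>I. lam t = 0) \<or>
    (\<exists>c. \<forall>t\<in>I. \<sigma> * B t + c \<noteq> 0 \<and> lam t = 2 * exp (A t) / (\<sigma> * B t + c))"
    (is "_ \<longleftrightarrow> ?zero \<or> ?formula")
proof
  have A: "\<And>t. t \<in> I \<Longrightarrow> (A has_real_derivative - \<sigma> * m t) (at t within I)"
    and B: "\<And>t. t \<in> I \<Longrightarrow> (B has_real_derivative n t * exp (A t)) (at t within I)"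
    using assms(5,6) by (simp_all add: antiderivative_on_def)
  have sA: "smooth_on I A"
    using A by (intro smooth_on_has_vector_derivative[of I A "\<lambda>t. - \<sigma> * m t"] smooth_on_mult
        smooth_on_const m) (simp add: has_real_derivative_iff_has_vector_derivative)
  have sB: "smooth_on I B"
    using B by (intro smooth_on_has_vector_derivative[of I B "\<lambda>t. n t * exp (A t)"] smooth_on_mult
        smooth_on_exp n sA) (simp add: has_real_derivative_iff_has_vector_derivative)
  {
    assume sol: "horocyclic_solution \<sigma> I m n lam"
    show "?zero \<or> ?formula"
    proof (rule disjCI)
      assume not: "\<not> ?formula"
      show ?zero
      proof (rule ccontr)
        assume "\<not> ?zero"
        then obtain r where r: "r \<in> I" "lam r \<noteq> 0"
          by blast
        have lam: "\<And>t. t \<in> I \<Longrightarrow> (lam has_real_derivative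
              - \<sigma> * ((lam t)\<^sup>2 * n t / 2 + lam t * m t)) (at t within I)"
          and slam: "smooth_on I lam"
          using sol by (simp_all add: horocyclic_solution_def)
        define d where "d = exp (A r) / lam r - \<sigma> * B r / 2"
        define z where "z = (\<lambda>t. lam t * exp (- A t) * (\<sigma> / 2 * B t + d) - 1)"
        have deriv: "(z has_real_derivative (- \<sigma> / 2 * n t * lam t) * z t) (at t within I)"
          if "t \<in> I" for t
          unfolding z_def
          by (rule derivative_eq_intros lam A B that refl)+
            (simp add: exp_minus field_simps power2_eq_square)
        have cont: "continuous_on I (\<lambda>t. - \<sigma> / 2 * n t * lam t)"
          by (intro smooth_on_imp_continuous_on smooth_on_mult smooth_on_const n slam)
        have zr: "z r = 0"
          using r by (simp add: z_def d_def exp_minus field_simps)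
        have z: "z t = 0" if "t \<in> I" for t
          using I linear_ode_zero_unique[OF _ cont deriv r(1) zr that]
          unfolding nontrivial_interval_def by blast
        \<comment> \<open>The constant of the formula is \<open>c = 2 * d\<close>. Vanishing of
          \<open>z\<close> says that \<open>lam\<close> times the denominator is
          \<open>2 * exp (A t)\<close>, which is never 0; so the denominator has no zero on
          \<open>I\<close>.\<close>
        have "\<sigma> * B t + 2 * d \<noteq> 0 \<and> lam t = 2 * exp (A t) / (\<sigma> * B t + 2 * d)" if "t \<in> I" for t
        proof -
          have "lam t * (\<sigma> * B t + 2 * d) = 2 * exp (A t)"
            using z[OF that] by (simp add: z_def exp_minus field_simps)
          moreover from this have "\<sigma> * B t + 2 * d \<noteq> 0"
            by auto
          ultimately show ?thesis
            by (simp add: field_simps)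
        qed
        with not show False
          by blast
      qed
    qed
  }
  show "horocyclic_solution \<sigma> I m n lam" if "?zero \<or> ?formula"
    using that
  proof
    assume ?zero
    moreover from this have "smooth_on I lam"
      by (intro smooth_on_cong[OF smooth_on_const[of I 0]]) simp
    \<comment> \<open>\<open>lam\<close> is known only on \<open>I\<close>, so the derivative is
      transferred from the constant 0; the radius 1 is arbitrary.\<close>
    moreover have "(lam has_real_derivative 0) (at t within I)" if "t \<in> I" for t
      by (rule has_field_derivative_transform_within[OF DERIV_const zero_less_one that])
        (simp add: \<open>?zero\<close>)
    ultimately show ?thesis
      by (simp add: horocyclic_solution_def)
  next
    assume ?formula
    then obtain c where c: "\<And>t. t \<in> I \<Longrightarrow> \<sigma> * B t + c \<noteq> 0"
      and lam: "\<And>t. t \<in> I \<Longrightarrow> lam t = 2 * exp (A t) / (\<sigma> * B t + c)"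
      by blast
    have "smooth_on I (\<lambda>t. 2 * exp (A t) * inverse (\<sigma> * B t + c))"
      by (intro smooth_on_mult smooth_on_const smooth_on_exp smooth_on_inverse smooth_on_add sA sB c)
    then have "smooth_on I lam"
      by (rule smooth_on_cong) (simp add: lam divide_inverse)
    moreover have "(lam has_real_derivative - \<sigma> * ((lam t)\<^sup>2 * n t / 2 + lam t * m t)) (at t within I)"
      if t: "t \<in> I" for t
    proof (rule has_field_derivative_transform_within[OF _ zero_less_one t])
      show "((\<lambda>t. 2 * exp (A t) / (\<sigma> * B t + c)) has_real_derivative
          - \<sigma> * ((lam t)\<^sup>2 * n t / 2 + lam t * m t)) (at t within I)"
        unfolding lam[OF t]
        by (rule derivative_eq_intros A B t c refl)+
          (use c[OF t] in \<open>simp add: divide_simps, simp add: power2_eq_square algebra_simps\<close>)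
    qed (simp add: lam)
    ultimately show ?thesis
      by (simp add: horocyclic_solution_def)
  qed
qed

lemma has_vector_derivative_horocyclic_parallel:
  assumes "spacelike_legendre_curve I \<gamma> \<nu>" and "has_legendre_curvature I \<gamma> \<nu> m n"
    and \<sigma>: "\<sigma> = 1 \<or> \<sigma> = -1" and "horocyclic_solution \<sigma> I m n lam" and "t \<in> I"
  shows "(horocyclic_parallel \<sigma> \<gamma> \<nu> lam has_vector_derivative
    (- \<sigma> * (m t + lam t * n t)) *\<^sub>R nu_N \<sigma> \<gamma> \<nu> (lam t, t)) (at t within I)"
proof -
  have D: "(\<gamma> t, \<nu> t) \<in> Delta1"
    using assms(1,5) by (simp add: spacelike_legendre_curve_def)
  let ?\<mu> = "wedge (\<gamma> t) (\<nu> t)"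
  let ?l' = "- \<sigma> * ((lam t)\<^sup>2 * n t / 2 + lam t * m t)"
  have \<gamma>: "(\<gamma> has_vector_derivative m t *\<^sub>R ?\<mu>) (at t within I)"
    and \<nu>: "(\<nu> has_vector_derivative n t *\<^sub>R ?\<mu>) (at t within I)"
    using assms(2,5) by (simp_all add: has_legendre_curvature_def)
  have lam: "(lam has_real_derivative ?l') (at t within I)"
    using assms(4,5) by (simp add: horocyclic_solution_def)
  have "((\<lambda>t. wedge (\<gamma> t) (\<nu> t)) has_vector_derivative
      wedge (\<gamma> t) (n t *\<^sub>R ?\<mu>) + wedge (m t *\<^sub>R ?\<mu>) (\<nu> t)) (at t within I)"
    by (rule bounded_bilinear.has_vector_derivative[OF bounded_bilinear_wedge \<gamma> \<nu>])
  \<comment> \<open>The triple product formulas produce \<mu>' = m \<gamma> - n \<nu>.\<close>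
  also have "wedge (\<gamma> t) (n t *\<^sub>R ?\<mu>) + wedge (m t *\<^sub>R ?\<mu>) (\<nu> t) = m t *\<^sub>R \<gamma> t - n t *\<^sub>R \<nu> t"
    by (simp add: bounded_bilinear.scaleR_left[OF bounded_bilinear_wedge]
        bounded_bilinear.scaleR_right[OF bounded_bilinear_wedge]
        wedge_wedge_left wedge_wedge_right Delta1_frame[OF D])
  finally have \<mu>: "((\<lambda>t. wedge (\<gamma> t) (\<nu> t)) has_vector_derivative m t *\<^sub>R \<gamma> t - n t *\<^sub>R \<nu> t)
      (at t within I)" .
  have q: "((\<lambda>t. (lam t)\<^sup>2 / 2) has_real_derivative lam t * ?l') (at t within I)"
    by (rule DERIV_cong[OF DERIV_cdivide[OF DERIV_power[OF lam, of 2], of 2]]) simp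
  have "((\<lambda>t. \<gamma> t + lam t *\<^sub>R \<nu> t + ((lam t)\<^sup>2 / 2) *\<^sub>R (\<gamma> t + \<sigma> *\<^sub>R wedge (\<gamma> t) (\<nu> t)))
      has_vector_derivative
        m t *\<^sub>R ?\<mu> + (lam t *\<^sub>R n t *\<^sub>R ?\<mu> + ?l' *\<^sub>R \<nu> t)
        + (((lam t)\<^sup>2 / 2) *\<^sub>R (m t *\<^sub>R ?\<mu> + \<sigma> *\<^sub>R (m t *\<^sub>R \<gamma> t - n t *\<^sub>R \<nu> t))
           + (lam t * ?l') *\<^sub>R (\<gamma> t + \<sigma> *\<^sub>R ?\<mu>))) (at t within I)"
    by (intro has_vector_derivative_add has_vector_derivative_scaleR \<gamma> \<nu> lam q
        bounded_linear.has_vector_derivative[OF bounded_linear_scaleR_right] \<mu>)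
  \<comment> \<open>The coefficients of \<gamma>, \<nu>, \<mu> agree: with \<open>?l'\<close> from
    the Riccati equation, each contains the factor \<open>m t + lam t * n t\<close>. The \<mu>
    coefficient also uses \<sigma>^2 = 1.\<close>
  moreover have "m t *\<^sub>R ?\<mu> + (lam t *\<^sub>R n t *\<^sub>R ?\<mu> + ?l' *\<^sub>R \<nu> t)
        + (((lam t)\<^sup>2 / 2) *\<^sub>R (m t *\<^sub>R ?\<mu> + \<sigma> *\<^sub>R (m t *\<^sub>R \<gamma> t - n t *\<^sub>R \<nu> t))
           + (lam t * ?l') *\<^sub>R (\<gamma> t + \<sigma> *\<^sub>R ?\<mu>))
      = (- \<sigma> * (m t + lam t * n t)) *\<^sub>R nu_N \<sigma> \<gamma> \<nu> (lam t, t)"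
    using \<sigma> by (auto simp: nu_N_def vec_eq_iff power2_eq_square field_simps)
  ultimately show ?thesis
    unfolding horocyclic_parallel_def by metis
qed

theorem proposition3p12:
  fixes I :: "real set" and \<gamma> \<nu> :: "real \<Rightarrow> real^3" and m n lam :: "real \<Rightarrow> real" and \<sigma> :: real
  assumes "spacelike_legendre_curve I \<gamma> \<nu>"
    and "has_legendre_curvature I \<gamma> \<nu> m n"
    and "I \<subseteq> closure {t \<in> I. n t \<noteq> 0}"
    and "\<sigma> = 1 \<or> \<sigma> = -1"
  shows "legendre_family UNIV I (x_N \<sigma> \<gamma> \<nu>) (nu_N \<sigma> \<gamma> \<nu>) \<and>
    (\<forall>A B. antiderivative_on I (\<lambda>t. - \<sigma> * m t) A \<and>
           antiderivative_on I (\<lambda>t. n t * exp (A t)) B \<longrightarrow>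
       (horocyclic_solution \<sigma> I m n lam \<longleftrightarrow>
          (\<forall>t\<in>I. lam t = 0) \<or>
          (\<exists>c. \<forall>t\<in>I. \<sigma> * B t + c \<noteq> 0 \<and> lam t = 2 * exp (A t) / (\<sigma> * B t + c)))) \<and>
    (horocyclic_solution \<sigma> I m n lam \<longrightarrow>
       pre_enveloid (pi / 2) UNIV I (x_N \<sigma> \<gamma> \<nu>) (nu_N \<sigma> \<gamma> \<nu>) I (\<lambda>t. (lam t, t)) \<and>
       (\<forall>t\<in>I. horocyclic_parallel \<sigma> \<gamma> \<nu> lam t = (x_N \<sigma> \<gamma> \<nu> \<circ> (\<lambda>t. (lam t, t))) t) \<and>
       enveloid (pi / 2) UNIV I (x_N \<sigma> \<gamma> \<nu>) (nu_N \<sigma> \<gamma> \<nu>) I (horocyclic_parallel \<sigma> \<gamma> \<nu> lam))"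
proof (intro conjI allI impI)
  have I: "nontrivial_interval I"
    using assms(1) by (simp add: spacelike_legendre_curve_def)
  show family: "legendre_family UNIV I (x_N \<sigma> \<gamma> \<nu>) (nu_N \<sigma> \<gamma> \<nu>)"
    by (rule legendre_family_x_N[OF assms(1,4)])
  show "horocyclic_solution \<sigma> I m n lam \<longleftrightarrow>
      (\<forall>t\<in>I. lam t = 0) \<or>
      (\<exists>c. \<forall>t\<in>I. \<sigma> * B t + c \<noteq> 0 \<and> lam t = 2 * exp (A t) / (\<sigma> * B t + c))"
    if "antiderivative_on I (\<lambda>t. - \<sigma> * m t) A \<and> antiderivative_on I (\<lambda>t. n t * exp (A t)) B" for A B
    using that horocyclic_solution_iff[OF I legendre_curvature_smooth[OF assms(1,2)] assms(4)] by blast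
  assume sol: "horocyclic_solution \<sigma> I m n lam"
  have parallel: "x_N \<sigma> \<gamma> \<nu> \<circ> (\<lambda>t. (lam t, t)) = horocyclic_parallel \<sigma> \<gamma> \<nu> lam"
    by (simp add: fun_eq_iff x_N_def horocyclic_parallel_def)
  show "\<forall>t\<in>I. horocyclic_parallel \<sigma> \<gamma> \<nu> lam t = (x_N \<sigma> \<gamma> \<nu> \<circ> (\<lambda>t. (lam t, t))) t"
    by (simp add: parallel)
  have "vector_derivative (horocyclic_parallel \<sigma> \<gamma> \<nu> lam) (at t within I)
      = (- \<sigma> * (m t + lam t * n t)) *\<^sub>R nu_N \<sigma> \<gamma> \<nu> (lam t, t)" if "t \<in> I" for t
    by (rule vector_derivative_within[OF nontrivial_interval_at_within_neq_bot[OF I that]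
          has_vector_derivative_horocyclic_parallel[OF assms(1,2,4) sol that]])
  \<comment> \<open>At angle \<open>pi / 2\<close> the prescribed direction, cosine times \<mu> plus
    sine times \<open>nu_N\<close>, is \<open>nu_N\<close> itself. The coefficient 1 on the
    derivative makes the relation nontrivial even where the parallel is singular.\<close>
  then have dep: "lin_dependent (vector_derivative (horocyclic_parallel \<sigma> \<gamma> \<nu> lam) (at t within I))
      (nu_N \<sigma> \<gamma> \<nu> (lam t, t))" if "t \<in> I" for t
    unfolding lin_dependent_def using that
    by (intro exI[of _ 1] exI[of _ "\<sigma> * (m t + lam t * n t)"]) simp
  have "smooth_on I (\<lambda>t. (lam t, t))"
    using sol by (intro smooth_on_Pair smooth_on_bounded_linear[OF bounded_linear_ident])
      (simp add: horocyclic_solution_def)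
  \<comment> \<open>The second component is the identity, so it separates any two points of
    \<open>V\<close>.\<close>
  moreover have "\<not> (snd \<circ> (\<lambda>t. (lam t, t))) constant_on V" if "nontrivial_interval V" for V
    using that unfolding nontrivial_interval_def constant_on_def comp_def snd_conv
    by (metis less_irrefl)
  ultimately show pre: "pre_enveloid (pi / 2) UNIV I (x_N \<sigma> \<gamma> \<nu>) (nu_N \<sigma> \<gamma> \<nu>) I (\<lambda>t. (lam t, t))"
    using family I dep by (auto simp: pre_enveloid_def parallel)
  show "enveloid (pi / 2) UNIV I (x_N \<sigma> \<gamma> \<nu>) (nu_N \<sigma> \<gamma> \<nu>) I (horocyclic_parallel \<sigma> \<gamma> \<nu> lam)"
    unfolding enveloid_def using pre parallel by metis
qed

end
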